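(* For every $n\in\mathbb{N}$, every isometric embedding of the unweighted cycle graph $C_{2n}$ (with its shortest-path metric) into $\ell_\infty$ requires at least $n$ coordinates. Furthermore, there is no function $\alpha:\mathbb{N}\rightarrow\mathbb{N}$ such that every cycle graph $C_n$, $n\in\mathbb{N}$, with every priority ordering of its vertices can be isometrically embedded into $\ell_\infty$ with prioritized dimension $\alpha$.
   Context: Given a priority ordering $x_1,\dots,x_m$ of the vertices, an embedding $f$ into $\ell_\infty$ has prioritized dimension $\alpha$ if $f(x_j)$ is non-zero only in its first $\alpha(j)$ coordinates. The function $\alpha$ may not depend on the graph size. *)

theory Defs
  imports "HOL-Analysis.Analysis" "Graph_Theory.Graph_Theory"
begin

(* Undirected graphs are symmetric loop-free digraphs. Degenerate cases: the cycle on 0, 1, 2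
   vertices is the empty graph, a single vertex, a single edge. *)
definition cycle_graph :: "nat \<Rightarrow> nat pair_pre_digraph" where
  "cycle_graph n =
    \<lparr> pverts = {..<n},
      parcs = {(u, v). u < n \<and> v < n \<and> u \<noteq> v \<and> (v = Suc u mod n \<or> u = Suc v mod n)} \<rparr>"

lemma pair_graph_cycle_graph: "pair_graph (cycle_graph n)"
proof
  have "parcs (cycle_graph n) \<subseteq> {..<n} \<times> {..<n}"
    by (auto simp: cycle_graph_def)
  then show "finite (parcs (cycle_graph n))"
    by (rule finite_subset) simp
  show "symmetric (with_proj (cycle_graph n))"
    by (auto simp: symmetric_def cycle_graph_def intro!: symI)
qed (auto simp: cycle_graph_def)

definition graph_distance :: "'a pair_pre_digraph \<Rightarrow> 'a \<Rightarrow> 'a \<Rightarrow> ereal" where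
  "graph_distance G = wf_digraph.\<mu> (with_proj G) (\<lambda>_. 1)"

definition isometric_embedding ::
    "'a pair_pre_digraph \<Rightarrow> ('a \<Rightarrow> 'b::metric_space) \<Rightarrow> bool" where
  "isometric_embedding G f \<longleftrightarrow>
    (\<forall>u\<in>pverts G. \<forall>v\<in>pverts G. ereal (dist (f u) (f v)) = graph_distance G u v)"

(* Every function on the discrete space nat is continuous, so the bounded continuous functions
   from nat to real with their supremum metric are the bounded real sequences. *)
type_synonym linf = "nat \<Rightarrow>\<^sub>C real"

(* Coordinates are indexed from 0: the first d coordinates are those with index i < d.
   With the metric of linf this set is a copy of d-dimensional real space with the maximum norm. *)
definition linf_first :: "nat \<Rightarrow> linf set" where
  "linf_first d = {x. \<forall>i\<ge>d. apply_bcontfun x i = 0}"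

definition priority_ordering :: "'a pair_pre_digraph \<Rightarrow> (nat \<Rightarrow> 'a) \<Rightarrow> bool" where
  "priority_ordering G x \<longleftrightarrow> bij_betw x {1..card (pverts G)} (pverts G)"

definition prioritized_dimension ::
    "'a pair_pre_digraph \<Rightarrow> (nat \<Rightarrow> 'a) \<Rightarrow> ('a \<Rightarrow> linf) \<Rightarrow> (nat \<Rightarrow> nat) \<Rightarrow> bool" where
  "prioritized_dimension G x f \<alpha> \<longleftrightarrow>
    (\<forall>j\<in>{1..card (pverts G)}. f (x j) \<in> linf_first (\<alpha> j))"

end

theory Submission
  imports Defs
begin

text \<open>
  A coordinate of an isometric embedding of \<open>C\<^bsub>2n\<^esub>\<close> is a 1-Lipschitz function. If it realises the
  distance \<open>n\<close> of one antipodal pair, it is forced to be affine with slope \<open>\<plusminus>1\<close> along both arcs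
  between the two points, so it realises no other antipodal pair. Hence the \<open>n\<close> antipodal pairs
  need \<open>n\<close> different coordinates.

  For prioritized dimension, give top priority to four equidistant vertices of \<open>C\<^bsub>4m\<^esub>\<close>. Every
  coordinate beyond \<open>max (\<alpha> 1) \<dots> (\<alpha> 4)\<close> vanishes at these four vertices, so it is smaller than \<open>m\<close>
  everywhere and cannot realise an antipodal distance \<open>2m\<close>. The \<open>2m\<close> antipodal pairs therefore all
  use coordinates below a bound that does not depend on \<open>m\<close>.
\<close>

lemma graph_distance_arc_le:
  assumes "pair_graph G" "(u, v) \<in> parcs G"
  shows "graph_distance G u v \<le> 1"
proof -
  interpret pair_graph G by fact
  have "awalk u [(u, v)] v"
    using arc_implies_awalk[of "(u, v)"] assms(2) by simp
  from min_cost_le_walk_cost[OF this, of "\<lambda>_. 1"] show ?thesis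
    by (simp add: graph_distance_def one_ereal_def)
qed

text \<open>A potential that gains at most 1 per arc bounds the cost of every walk from below, hence
  also their infimum \<open>\<mu>\<close>. Distances can thus be bounded without knowing the
  shortest walks.\<close>

lemma graph_distance_ge_Lipschitz:
  fixes \<phi> :: "'a \<Rightarrow> real"
  assumes "pair_graph G"
    and Lipschitz: "\<And>u v. (u, v) \<in> parcs G \<Longrightarrow> \<phi> v \<le> \<phi> u + 1"
  shows "ereal (\<phi> v - \<phi> u) \<le> graph_distance G u v"
proof -
  interpret pair_graph G by fact
  have "\<phi> v - \<phi> u \<le> awalk_cost (\<lambda>_. 1) p" if "awalk u p v" for p
    using that
  proof (induction p arbitrary: u)
    case Nil
    then show ?case by (simp add: awalk_Nil_iff)
  next
    case (Cons e p)
    then obtain w where "e = (u, w)" "(u, w) \<in> parcs G" "awalk w p v"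
      by (cases e) (auto simp: awalk_Cons_iff)
    with Cons.IH[of w] Lipschitz[of u w] show ?case by simp
  qed
  then show ?thesis
    by (auto simp: graph_distance_def \<mu>_def intro: INF_greatest)
qed

lemma dist_cycle_graph_le:
  assumes iso: "isometric_embedding (cycle_graph N) f" and "N > 0"
  shows "dist (f (a mod N)) (f ((a + t) mod N)) \<le> real t"
proof (induction t)
  case 0
  then show ?case by simp
next
  case (Suc t)
  let ?u = "(a + t) mod N" and ?v = "(a + Suc t) mod N"
  have "dist (f ?u) (f ?v) \<le> 1"
  \<comment> \<open>Equality occurs only for \<open>N = 1\<close>, where the graph has no
    arc.\<close>
  proof (cases "?u = ?v")
    case False
    have "?v = Suc ?u mod N" by (simp add: mod_Suc_eq)
    with False \<open>N > 0\<close> have "(?u, ?v) \<in> parcs (cycle_graph N)"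
      by (simp add: cycle_graph_def)
    then have "graph_distance (cycle_graph N) ?u ?v \<le> 1"
      by (rule graph_distance_arc_le[OF pair_graph_cycle_graph])
    moreover have "ereal (dist (f ?u) (f ?v)) = graph_distance (cycle_graph N) ?u ?v"
      using iso \<open>N > 0\<close> by (simp add: isometric_embedding_def cycle_graph_def)
    ultimately have "ereal (dist (f ?u) (f ?v)) \<le> ereal 1"
      by (simp add: one_ereal_def)
    then show ?thesis by simp
  qed simp
  with Suc dist_triangle[of "f (a mod N)" "f ?v" "f ?u"] show ?case by simp
qed

lemma dist_antipodal_ge:
  assumes iso: "isometric_embedding (cycle_graph (2 * n)) f" and "k < n"
  shows "real n \<le> dist (f k) (f (k + n))"
proof -
  \<comment> \<open>The distance to \<open>k\<close> along the shorter way round the cycle, as an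
    explicit potential; it is 0 at \<open>k\<close> and \<open>n\<close> at
    \<open>k + n\<close>.\<close>
  define \<phi> where "\<phi> v = min \<bar>real v - real k\<bar> (2 * real n - \<bar>real v - real k\<bar>)" for v
  have Suc: "\<phi> (Suc u mod (2 * n)) \<le> \<phi> u + 1 \<and> \<phi> u \<le> \<phi> (Suc u mod (2 * n)) + 1"
    if "u < 2 * n" for u
  \<comment> \<open>The arc from \<open>2 * n - 1\<close> back to 0 is the one where
    \<open>Suc u\<close> wraps around.\<close>
  proof (cases "Suc u = 2 * n")
    case True
    then have "real u = 2 * real n - 1" by linarith
    moreover have "Suc u mod (2 * n) = 0" using True by simp
    ultimately show ?thesis using \<open>k < n\<close> by (simp add: \<phi>_def min_def abs_if)
  next
    case False
    with that show ?thesis by (simp add: \<phi>_def min_def abs_if)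
  qed
  have "\<phi> v \<le> \<phi> u + 1" if "(u, v) \<in> parcs (cycle_graph (2 * n))" for u v
    using that Suc[of u] Suc[of v] by (auto simp: cycle_graph_def)
  from graph_distance_ge_Lipschitz[of "cycle_graph (2 * n)" \<phi> "k + n" k, OF pair_graph_cycle_graph this]
  have "ereal (real n) \<le> graph_distance (cycle_graph (2 * n)) k (k + n)"
    by (simp add: \<phi>_def)
  moreover have "ereal (dist (f k) (f (k + n))) = graph_distance (cycle_graph (2 * n)) k (k + n)"
    using iso \<open>k < n\<close> by (simp add: isometric_embedding_def cycle_graph_def)
  ultimately have "ereal (real n) \<le> ereal (dist (f k) (f (k + n)))" by simp
  then show ?thesis by simp
qed

text \<open>The points \<open>j\<close>, \<open>k\<close>, \<open>j + n\<close>,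
  \<open>k + n\<close> cut the cycle into arcs of lengths \<open>t\<close>, \<open>s\<close>,
  \<open>t\<close>, \<open>s\<close> with \<open>t + s = n\<close>. If \<open>g\<close> rises by
  \<open>n\<close> from \<open>j\<close> to \<open>j + n\<close>, then \<open>g k = g j + t\<close>
  and \<open>g (k + n) = g j + s\<close>. These differ by less than \<open>t + s\<close> when both
  lengths are positive.\<close>

lemma Lipschitz_antipodal_unique:
  fixes g :: "nat \<Rightarrow> real"
  assumes Lipschitz: "\<And>a t. \<bar>g a - g (a + t)\<bar> \<le> real t"
    and periodic: "g (j + 2 * n) = g j"
    and j: "\<bar>g j - g (j + n)\<bar> \<ge> real n" and k: "\<bar>g k - g (k + n)\<bar> \<ge> real n"
    and "j \<le> k" "k < n"
  shows "j = k"
proof (rule ccontr)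
  assume "j \<noteq> k"
  define t s where "t = k - j" and "s = n - t"
  have t: "k = j + t" "t > 0" using \<open>j \<noteq> k\<close> \<open>j \<le> k\<close> by (simp_all add: t_def)
  have s: "n = t + s" "s > 0" using \<open>k < n\<close> t by (simp_all add: s_def)
  have "\<bar>g j - g k\<bar> \<le> real t" using Lipschitz[of j t] t by simp
  moreover have "\<bar>g k - g (j + n)\<bar> \<le> real s" using Lipschitz[of k s] t s by (simp add: ac_simps)
  moreover have "\<bar>g (j + n) - g (k + n)\<bar> \<le> real t"
    using Lipschitz[of "j + n" t] t by (simp add: ac_simps)
  moreover have "\<bar>g (k + n) - g j\<bar> \<le> real s"
    using Lipschitz[of "k + n" s] periodic t s by (simp add: ac_simps mult_2_right)
  moreover have "real n = real t + real s" "real t > 0" "real s > 0" using s t by simp_all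
  ultimately show False using j k by (smt (verit))
qed

text \<open>Common core of both claims: \<open>I\<close> holds the coordinates able to realise an
  antipodal distance. The uniform gap \<open>c < n\<close> outside \<open>I\<close> matters because
  a supremum of infinitely many values below \<open>n\<close> could still equal
  \<open>n\<close>.\<close>

lemma isometric_embedding_cycle_graph_card_ge:
  fixes f :: "nat \<Rightarrow> linf"
  assumes iso: "isometric_embedding (cycle_graph (2 * n)) f"
    and "finite I" and "c < real n"
    and outside: "\<And>k i. k < n \<Longrightarrow> i \<notin> I \<Longrightarrow> dist (f k i) (f (k + n) i) \<le> c"
  shows "n \<le> card I"
proof -
  have "\<exists>i\<in>I. real n \<le> dist (f k i) (f (k + n) i)" if "k < n" for k
  proof (rule ccontr)
    assume "\<not> ?thesis"
    then have less: "dist (f k i) (f (k + n) i) < real n" if "i \<in> I" for i using that by force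
    define b where "b = Max (insert c ((\<lambda>i. dist (f k i) (f (k + n) i)) ` I))"
    have "dist (f k i) (f (k + n) i) \<le> b" for i
    proof (cases "i \<in> I")
      case True
      then show ?thesis using \<open>finite I\<close> by (simp add: b_def)
    next
      case False
      then have "dist (f k i) (f (k + n) i) \<le> c" using outside \<open>k < n\<close> by simp
      also have "c \<le> b" using \<open>finite I\<close> by (simp add: b_def)
      finally show ?thesis .
    qed
    then have "dist (f k) (f (k + n)) \<le> b" by (rule dist_bound)
    also have "b < real n"
      using less \<open>c < real n\<close> \<open>finite I\<close> by (simp add: b_def)
    finally show False using dist_antipodal_ge[OF iso \<open>k < n\<close>] by simp
  qed
  then obtain h where h: "\<And>k. k < n \<Longrightarrow> h k \<in> I \<and> real n \<le> dist (f k (h k)) (f (k + n) (h k))"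
    by metis
  have unique: "j = k" if "j \<le> k" "k < n" "h j = h k" for j k
  proof -
    \<comment> \<open>Coordinate \<open>h k\<close> unrolled to a periodic function, so that arcs
      through vertex 0 need no special treatment.\<close>
    define g where "g a = f (a mod (2 * n)) (h k)" for a
    have Lipschitz: "\<bar>g a - g (a + t)\<bar> \<le> real t" for a t
    proof -
      have "dist (g a) (g (a + t)) \<le> dist (f (a mod (2 * n))) (f ((a + t) mod (2 * n)))"
        unfolding g_def by (rule dist_bounded)
      also have "\<dots> \<le> real t" using dist_cycle_graph_le[OF iso] \<open>k < n\<close> by simp
      finally show ?thesis by (simp add: dist_real_def)
    qed
    show "j = k"
    proof (rule Lipschitz_antipodal_unique[where g = g and n = n])
      show "g (j + 2 * n) = g j" by (simp add: g_def)
      show "real n \<le> \<bar>g j - g (j + n)\<bar>" "real n \<le> \<bar>g k - g (k + n)\<bar>"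
        using h[of j] h[of k] that by (simp_all add: g_def dist_real_def)
    qed (use Lipschitz that in auto)
  qed
  have "inj_on h {..<n}"
  proof (rule inj_onI)
    fix j k assume "j \<in> {..<n}" "k \<in> {..<n}" "h j = h k"
    then show "j = k" using unique[of j k] unique[of k j] by (cases "j \<le> k") auto
  qed
  moreover have "h ` {..<n} \<subseteq> I" using h by auto
  ultimately show ?thesis using card_inj_on_le[of h "{..<n}" I] \<open>finite I\<close> by simp
qed

lemma isometric_embedding_cycle_graph_dimension_ge:
  fixes f :: "nat \<Rightarrow> linf"
  assumes iso: "isometric_embedding (cycle_graph (2 * n)) f"
    and dim: "f ` pverts (cycle_graph (2 * n)) \<subseteq> linf_first d"
  shows "n \<le> d"
\<comment> \<open>The bound \<open>c = 0\<close> used below is smaller than \<open>n\<close> only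
  for positive \<open>n\<close>.\<close>
proof (cases "n = 0")
  case False
  have "f v i = 0" if "v < 2 * n" "i \<ge> d" for v i
    using dim that by (auto simp: cycle_graph_def linf_first_def)
  with False show ?thesis
    using isometric_embedding_cycle_graph_card_ge[OF iso, of "{..<d}" 0] by simp
qed simp

text \<open>Any chosen set of vertices can be given top priority: a bijection onto \<open>S\<close>
  is glued to one onto its complement.\<close>

lemma priority_ordering_exists:
  assumes "finite (pverts G)" "S \<subseteq> pverts G"
  obtains x where "priority_ordering G x" "x ` {1..card S} = S"
proof -
  have "finite S" using assms finite_subset by blast
  define A B where "A = {1..card S}" and "B = {card S<..card (pverts G)}"
  have le: "card S \<le> card (pverts G)" using assms card_mono by blast
  have "card (pverts G - S) = card B"
    using assms \<open>finite S\<close> by (simp add: B_def card_Diff_subset)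
  then obtain q where q: "bij_betw q B (pverts G - S)"
    using finite_same_card_bij[of B "pverts G - S"] assms(1) by (auto simp: B_def)
  obtain p where p: "bij_betw p A S"
    using finite_same_card_bij[of A S] \<open>finite S\<close> by (auto simp: A_def)
  define x where "x j = (if j \<in> A then p j else q j)" for j
  have xA: "bij_betw x A S"
    using p by (subst bij_betw_cong[of _ _ p]) (auto simp: x_def)
  have xB: "bij_betw x B (pverts G - S)"
    using q by (subst bij_betw_cong[of _ _ q]) (auto simp: x_def A_def B_def)
  have "A \<union> B = {1..card (pverts G)}" "S \<union> (pverts G - S) = pverts G"
    using le assms(2) by (auto simp: A_def B_def)
  with bij_betw_combine[OF xA xB] have "priority_ordering G x"
    by (simp add: priority_ordering_def)
  moreover have "x ` {1..card S} = S"
    using xA by (simp add: bij_betw_def A_def)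
  ultimately show thesis by (rule that)
qed

lemma no_prioritized_isometric_embedding:
  fixes \<alpha> :: "nat \<Rightarrow> nat"
  obtains n x where "priority_ordering (cycle_graph n) x"
    "\<And>f. isometric_embedding (cycle_graph n) f \<Longrightarrow> \<not> prioritized_dimension (cycle_graph n) x f \<alpha>"
proof -
  \<comment> \<open>\<open>d\<close> depends on \<alpha> alone, and \<open>m\<close> is then chosen
    so that the \<open>2 * m\<close> antipodal pairs outnumber the coordinates below
    \<open>d\<close>.\<close>
  define d where "d = Max (\<alpha> ` {1..4})"
  define m where "m = Suc d"
  define S where "S = (\<lambda>q. q * m) ` {..<4}"
  let ?C = "cycle_graph (2 * (2 * m))"
  have "m > 0" by (simp add: m_def)
  then have "inj_on (\<lambda>q. q * m) {..<4}" by (simp add: inj_on_def)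
  then have card_S: "card S = 4" by (simp add: S_def card_image)
  have verts: "pverts ?C = {..<4 * m}" by (simp add: cycle_graph_def)
  have "S \<subseteq> pverts ?C" using \<open>m > 0\<close> unfolding S_def verts by auto
  then obtain x where x: "priority_ordering ?C x" "x ` {1..4} = S"
    using priority_ordering_exists[of ?C S] card_S verts by auto
  have "\<not> prioritized_dimension ?C x f \<alpha>" if iso: "isometric_embedding ?C f" for f
  proof
    assume dim: "prioritized_dimension ?C x f \<alpha>"
    have zero: "f (q * m) i = 0" if "q < 4" "i \<ge> d" for q i
    proof -
      have "q * m \<in> x ` {1..4}" using x(2) \<open>q < 4\<close> by (auto simp: S_def)
      then obtain j where j: "j \<in> {1..4}" "x j = q * m" by auto
      then have "\<alpha> j \<le> d" by (simp add: d_def)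
      moreover have "f (q * m) \<in> linf_first (\<alpha> j)"
        using dim j \<open>m > 0\<close> unfolding prioritized_dimension_def verts by force
      ultimately show ?thesis using \<open>i \<ge> d\<close> by (simp add: linf_first_def)
    qed
    \<comment> \<open>The last vertex of \<open>S\<close> at or before \<open>v\<close> is
      \<open>v mod m\<close> steps away, at most \<open>m - 1\<close>, and coordinate
      \<open>i\<close> vanishes there.\<close>
    have small: "\<bar>f v i\<bar> \<le> real m - 1" if "v < 4 * m" "i \<ge> d" for v i
    proof -
      have q: "v div m < 4" using that by (simp add: less_mult_imp_div_less)
      have "v div m * m \<le> v" by simp
      then have mod: "(v div m * m) mod (2 * (2 * m)) = v div m * m" "v mod (2 * (2 * m)) = v"
        using that q by simp_all
      have "\<bar>f v i\<bar> = dist (f (v div m * m) i) (f v i)"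
        using zero[OF q \<open>i \<ge> d\<close>] by (simp add: dist_real_def)
      also have "\<dots> \<le> dist (f (v div m * m)) (f v)" by (rule dist_bounded)
      also have "\<dots> \<le> real (v mod m)"
        using dist_cycle_graph_le[OF iso, of "v div m * m" "v mod m"] \<open>m > 0\<close> mod by (simp add: mult.commute)
      also have "\<dots> \<le> real m - 1"
        using mod_less_divisor[OF \<open>m > 0\<close>, of v] by linarith
      finally show ?thesis .
    qed
    have "2 * m \<le> card {..<d}"
    proof (rule isometric_embedding_cycle_graph_card_ge[OF iso])
      \<comment> \<open>Twice the bound \<open>m - 1\<close> from \<open>small\<close>, since the
        two antipodal values may have opposite signs.\<close>
      show "2 * real m - 2 < real (2 * m)" by simp
      fix k i assume "k < 2 * m" "i \<notin> {..<d}"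
      then show "dist (f k i) (f (k + 2 * m) i) \<le> 2 * real m - 2"
        using small[of k i] small[of "k + 2 * m" i] by (simp add: dist_real_def)
    qed simp
    then show False by (simp add: m_def)
  qed
  with x(1) show thesis by (rule that)
qed

theorem theorem5p1:
  shows "(\<forall>(n::nat) (d::nat) (f :: nat \<Rightarrow> linf).
            isometric_embedding (cycle_graph (2 * n)) f \<longrightarrow>
            f ` pverts (cycle_graph (2 * n)) \<subseteq> linf_first d \<longrightarrow> n \<le> d)
       \<and> \<not> (\<exists>\<alpha> :: nat \<Rightarrow> nat. \<forall>(n::nat) (x :: nat \<Rightarrow> nat).
            priority_ordering (cycle_graph n) x \<longrightarrow>
            (\<exists>f :: nat \<Rightarrow> linf. isometric_embedding (cycle_graph n) f \<and>
               prioritized_dimension (cycle_graph n) x f \<alpha>))"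
proof (intro conjI allI impI notI; (elim exE)?)
  fix n d :: nat and f :: "nat \<Rightarrow> linf"
  assume "isometric_embedding (cycle_graph (2 * n)) f"
    and "f ` pverts (cycle_graph (2 * n)) \<subseteq> linf_first d"
  then show "n \<le> d" by (rule isometric_embedding_cycle_graph_dimension_ge)
next
  fix \<alpha> :: "nat \<Rightarrow> nat"
  assume "\<forall>n x. priority_ordering (cycle_graph n) x \<longrightarrow>
    (\<exists>f. isometric_embedding (cycle_graph n) f \<and> prioritized_dimension (cycle_graph n) x f \<alpha>)"
  then show False by (metis no_prioritized_isometric_embedding[of \<alpha>])
qed

end
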